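(* For any locally adaptive randomized protocol $\mathcal{P}$ for Geocast such that uninformed nodes never transmit, any $V_{\max}>0$, any $d>r$ (where $r>0$ is the range of transmission and $d$ is the Geocast eccentricity), any integers $\alpha\ge 0$, $\beta>0$, and any positive integer $k$ such that $\left(\frac{2}{1-1/e}\right)^{\xi/e}<k<n$, where $\xi=2/(1-1/e)^2$, there exists an $(\alpha,\beta)$-connected MANET formed by a set $V$ of $n$ nodes (with node speeds bounded by $V_{\max}$) such that, if $\beta<\dfrac{k}{2e\Gamma}$, where $\Gamma=\xi\ln\delta$ and $\delta=\beta^2k^{e/\xi}$, then, within $\beta$ steps after $k$ nodes were covered, in expectation no new node is covered, even if all nodes were activated simultaneously and do not fail.
   Context: **Model.** A MANET is a set $V$ of $n$ nodes in $\mathbb{R}^2$, no two at the same point at the same time. Time is divided into slots $1,2,\dots$; the topology changes only at slot boundaries, and no node moves faster than $V_{\max}$. All nodes have the same range of transmission $r>0$; two nodes are neighbors in a slot if their distance is at most $r$ during the whole slot. An active node $u$ receives a transmission from a neighbor $v$ in a slot if and only if $v$ is the only node transmitting in that slot among $u$ and its neighbors. There is no collision detection. Nodes may be activated at any slot boundary, and may fail (become inactive) and be reactivated; upon activation a node starts its algorithm from scratch, keeping no state. Slots counted from a node's activation are its (local) steps. **Geocast.** A source node $s$ holds a piece of information $I$ at time $t_1$. $I$ must be delivered to all nodes that at time $t_1$ are active and located within distance $d$ (the eccentricity) of the position of $s$ at that time. A node is covered if it has received $I$ (the source, which holds $I$, counts as covered), otherwise uncovered. A node is informed at time $t$ if it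 holds $I$ at time $t$, otherwise uninformed. The problem is solved at slot $t_2\ge t_1$ if all target nodes are covered by slot $t_2$. **$(\alpha,\beta)$-connectivity** (integers $\alpha\ge0$, $\beta\ge1$). For every slot $t\ge t_1$ at which the problem is not yet solved there is a slot $t'$ such that $[t,t+\alpha]\cap[t',t'+\beta)\neq\emptyset$, and there are nodes $p,p'$ such that at time $t'$ $p$ is informed and $p'$ is uncovered, and $p,p'$ are active and neighbors from step $t'$ until $p'$ becomes covered or until step $t'+\beta-1$ (inclusive), whichever occurs first. **Adversary.** Node movement and activation schedules are controlled by an adaptive adversary, which decides at the end of each slot with access to all nodes' internal states but not to future random bits, subject to the speed bound and $(\alpha,\beta)$-connectivity. "There exists an $(\alpha,\beta)$-connected MANET" refers to a configuration and movement of nodes produced by such an adversary. Expectation is over the protocol's random bits. **Protocols.** Let $s(i,t)\in\{T,R\}^t$ be the transmission/reception schedule of node $i$ in its first $t$ steps. A randomized protocol is locally adaptive if it can be modeled by a set $\{\pi_i : i\in V\}$ of transmission-probability functions such that a covered node $i$ transmits with probability $\pi_i(t,s(i,t-1))$ in the $t$-th step after its activation (no information from other nodes or the channel is used, and the random choices of different nodes are independent). *)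

theory Defs
  imports "HOL-Probability.Probability"
begin

text \<open>
  A history is the list of transmitter sets of the slots elapsed so far, newest first.  Together
  with the adversary's own decisions it determines the internal state of every node.  The
  history \<open>h\<close> stands for the instant at which slot \<open>slot h\<close> begins (slots are numbered from 1); this
  instant is ``time \<open>slot h\<close>''.
\<close>

type_synonym 'v history = "'v set list"

definition slot :: "'v history \<Rightarrow> nat" where
  "slot h = Suc (length h)"

text \<open>
  The adversary's decisions for the slot that begins after \<open>h\<close> are functions of \<open>h\<close>, so they may
  depend on everything that has happened but not on future random bits.  A slot lasts one unit of
  time, and \<open>motion M h v z\<close> with \<open>0 \<le> z \<le> 1\<close> is the position of \<open>v\<close> at the fraction \<open>z\<close> of that
  slot.
\<close>

record 'v manet =
  source :: 'v
  start :: nat  \<comment> \<open>the time at which the source holds the information\<close>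
  motion :: "'v history \<Rightarrow> 'v \<Rightarrow> real \<Rightarrow> real ^ 2"
  active :: "'v history \<Rightarrow> 'v set"

definition neighbors :: "real \<Rightarrow> 'v manet \<Rightarrow> 'v history \<Rightarrow> 'v \<Rightarrow> 'v \<Rightarrow> bool" where
  "neighbors r M h u v \<longleftrightarrow>
     u \<noteq> v \<and> (\<forall>z\<in>{0..1}. dist (motion M h u z) (motion M h v z) \<le> r)"

definition receivers :: "'v set \<Rightarrow> real \<Rightarrow> 'v manet \<Rightarrow> 'v history \<Rightarrow> 'v set \<Rightarrow> 'v set" where
  "receivers V r M h T =
     {u \<in> V \<inter> active M h. \<exists>v\<in>V. neighbors r M h u v \<and>
        {w \<in> V. w \<in> T \<and> (w = u \<or> neighbors r M h u w)} = {v}}"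

definition injected :: "'v manet \<Rightarrow> 'v history \<Rightarrow> 'v set" where
  "injected M h = (if slot h = start M then {source M} else {})"

text \<open>
  Only informed nodes transmit, so every reception delivers the information.  A node that is inactive
  during a slot loses it, but remains covered.
\<close>

fun informed :: "'v set \<Rightarrow> real \<Rightarrow> 'v manet \<Rightarrow> 'v history \<Rightarrow> 'v set" where
  "informed V r M [] = injected M []"
| "informed V r M (T # h) =
     (informed V r M h \<inter> active M h) \<union> receivers V r M h T \<union> injected M (T # h)"

fun covered :: "'v set \<Rightarrow> real \<Rightarrow> 'v manet \<Rightarrow> 'v history \<Rightarrow> 'v set" where
  "covered V r M [] = injected M []"
| "covered V r M (T # h) = covered V r M h \<union> receivers V r M h T \<union> injected M (T # h)"

datatype action = Transmit | Receive

text \<open>The schedule of a node since its latest activation, in chronological order.\<close>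

fun schedule :: "'v manet \<Rightarrow> 'v history \<Rightarrow> 'v \<Rightarrow> action list" where
  "schedule M [] v = []"
| "schedule M (T # h) v =
     (if v \<in> active M h then schedule M h v @ [if v \<in> T then Transmit else Receive] else [])"

text \<open>\<open>\<pi> i t s\<close> is the probability that node \<open>i\<close> transmits in its \<open>t\<close>-th step after schedule \<open>s\<close>.\<close>

type_synonym 'v protocol = "'v \<Rightarrow> nat \<Rightarrow> action list \<Rightarrow> real"

definition locally_adaptive :: "'v set \<Rightarrow> 'v protocol \<Rightarrow> bool" where
  "locally_adaptive V \<pi> \<longleftrightarrow>
     (\<forall>i\<in>V. \<forall>t\<ge>1. \<forall>s. length s = t - 1 \<longrightarrow> 0 \<le> \<pi> i t s \<and> \<pi> i t s \<le> 1)"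

definition transmit_prob ::
  "'v set \<Rightarrow> real \<Rightarrow> 'v protocol \<Rightarrow> 'v manet \<Rightarrow> 'v history \<Rightarrow> 'v \<Rightarrow> real" where
  "transmit_prob V r \<pi> M h v =
     (if v \<in> active M h \<and> v \<in> informed V r M h
      then \<pi> v (Suc (length (schedule M h v))) (schedule M h v) else 0)"

definition transmitters ::
  "'v set \<Rightarrow> real \<Rightarrow> 'v protocol \<Rightarrow> 'v manet \<Rightarrow> 'v history \<Rightarrow> 'v set pmf" where
  "transmitters V r \<pi> M h =
     map_pmf (\<lambda>f. {v \<in> V. f v})
       (Pi_pmf V False (\<lambda>v. bernoulli_pmf (transmit_prob V r \<pi> M h v)))"

text \<open>\<open>exec V r \<pi> M j h\<close> is the distribution of the history \<open>j\<close> slots after the history \<open>h\<close>.\<close>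

fun exec ::
  "'v set \<Rightarrow> real \<Rightarrow> 'v protocol \<Rightarrow> 'v manet \<Rightarrow> nat \<Rightarrow> 'v history \<Rightarrow> 'v history pmf" where
  "exec V r \<pi> M 0 h = return_pmf h"
| "exec V r \<pi> M (Suc j) h =
     bind_pmf (transmitters V r \<pi> M h) (\<lambda>T. exec V r \<pi> M j (T # h))"

definition possible ::
  "'v set \<Rightarrow> real \<Rightarrow> 'v protocol \<Rightarrow> 'v manet \<Rightarrow> 'v history \<Rightarrow> bool" where
  "possible V r \<pi> M h \<longleftrightarrow> h \<in> set_pmf (exec V r \<pi> M (length h) [])"

text \<open>\<open>V\<close> is the set of nodes, \<open>r\<close> the range of transmission, \<open>vmax\<close> the bound on the speed.\<close>

definition is_manet ::
  "'v set \<Rightarrow> real \<Rightarrow> real \<Rightarrow> 'v protocol \<Rightarrow> 'v manet \<Rightarrow> bool" where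
  "is_manet V r vmax \<pi> M \<longleftrightarrow>
     source M \<in> V \<and> 1 \<le> start M \<and>
     (\<forall>h. possible V r \<pi> M h \<longrightarrow>
        active M h \<subseteq> V \<and>
        (slot h = start M \<longrightarrow> source M \<in> active M h) \<and>
        (\<forall>v\<in>V. \<forall>y\<in>{0..1}. \<forall>z\<in>{0..1}.
           dist (motion M h v y) (motion M h v z) \<le> vmax * \<bar>y - z\<bar>) \<and>
        (\<forall>u\<in>V. \<forall>v\<in>V. u \<noteq> v \<longrightarrow> (\<forall>z\<in>{0..1}. motion M h u z \<noteq> motion M h v z)) \<and>
        (\<forall>T. possible V r \<pi> M (T # h) \<longrightarrow>
           (\<forall>v\<in>V. motion M (T # h) v 0 = motion M h v 1)))"

text \<open>
  A run gives the transmitter set of every slot; \<open>history_at \<omega> t\<close> is the history at the beginning of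
  slot \<open>t\<close>.
\<close>

definition history_at :: "(nat \<Rightarrow> 'v set) \<Rightarrow> nat \<Rightarrow> 'v history" where
  "history_at \<omega> t = rev (map \<omega> [1..<t])"

definition run ::
  "'v set \<Rightarrow> real \<Rightarrow> 'v protocol \<Rightarrow> 'v manet \<Rightarrow> (nat \<Rightarrow> 'v set) \<Rightarrow> bool" where
  "run V r \<pi> M \<omega> \<longleftrightarrow> (\<forall>t\<ge>1. possible V r \<pi> M (history_at \<omega> t))"

text \<open>To be used for a history \<open>h\<close> with \<open>slot h = start M\<close>.\<close>

definition targets :: "'v set \<Rightarrow> real \<Rightarrow> 'v manet \<Rightarrow> 'v history \<Rightarrow> 'v set" where
  "targets V d M h =
     {v \<in> V \<inter> active M h. dist (motion M h v 0) (motion M h (source M) 0) \<le> d}"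

definition solved ::
  "'v set \<Rightarrow> real \<Rightarrow> real \<Rightarrow> 'v manet \<Rightarrow> (nat \<Rightarrow> 'v set) \<Rightarrow> nat \<Rightarrow> bool" where
  "solved V r d M \<omega> t \<longleftrightarrow>
     targets V d M (history_at \<omega> (start M)) \<subseteq> covered V r M (history_at \<omega> t)"

text \<open>
  Coverage at slot \<open>t\<close> is evaluated at the beginning of the slot.  The guard on
  \<open>p'\<close> below releases the link from the slot after the one in which \<open>p'\<close> receives.
\<close>

definition ab_connected ::
  "nat \<Rightarrow> nat \<Rightarrow> 'v set \<Rightarrow> real \<Rightarrow> real \<Rightarrow> 'v protocol \<Rightarrow> 'v manet \<Rightarrow> bool" where
  "ab_connected \<alpha> \<beta> V r d \<pi> M \<longleftrightarrow>
     (\<forall>\<omega>. run V r \<pi> M \<omega> \<longrightarrow> (\<forall>t\<ge>start M. \<not> solved V r d M \<omega> t \<longrightarrow>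
        (\<exists>t'\<ge>1. {t..t + \<alpha>} \<inter> {t'..<t' + \<beta>} \<noteq> {} \<and>
           (\<exists>p\<in>V. \<exists>p'\<in>V.
              p \<in> informed V r M (history_at \<omega> t') \<and>
              p' \<notin> covered V r M (history_at \<omega> t') \<and>
              (\<forall>i\<in>{t'..<t' + \<beta>}. p' \<notin> covered V r M (history_at \<omega> i) \<longrightarrow>
                 p \<in> active M (history_at \<omega> i) \<and> p' \<in> active M (history_at \<omega> i) \<and>
                 neighbors r M (history_at \<omega> i) p p')))))"

text \<open>
  Connectivity demands nothing once the problem is solved, so a network with few targets could
  isolate the remaining nodes; hence the requirement that all nodes be targets.
\<close>

definition all_targets ::
  "'v set \<Rightarrow> real \<Rightarrow> real \<Rightarrow> 'v protocol \<Rightarrow> 'v manet \<Rightarrow> bool" where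
  "all_targets V r d \<pi> M \<longleftrightarrow>
     (\<forall>h. possible V r \<pi> M h \<and> slot h = start M \<longrightarrow> targets V d M h = V)"

definition simultaneous_without_failures ::
  "'v set \<Rightarrow> real \<Rightarrow> 'v protocol \<Rightarrow> 'v manet \<Rightarrow> bool" where
  "simultaneous_without_failures V r \<pi> M \<longleftrightarrow>
     (\<exists>a. \<forall>h. possible V r \<pi> M h \<longrightarrow> active M h = (if a \<le> slot h then V else {}))"

definition expected_newly_covered ::
  "'v set \<Rightarrow> real \<Rightarrow> 'v protocol \<Rightarrow> 'v manet \<Rightarrow> nat \<Rightarrow> 'v history \<Rightarrow> real" where
  "expected_newly_covered V r \<pi> M j h =
     measure_pmf.expectation (exec V r \<pi> M j h)
       (\<lambda>h'. real (card (covered V r M h' - covered V r M h)))"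

text \<open>
  In every execution in which at least \<open>k\<close> nodes become covered, there is a moment with exactly \<open>k\<close>
  covered nodes, and given the history up to the slot in which the number of covered nodes reaches
  \<open>k\<close>, the expected number of nodes covered in the following \<open>\<beta>\<close> slots is below one.  Without
  exactness a witness could skip \<open>k\<close>, e.g. by covering all nodes in one slot.
\<close>

definition no_new_node_covered ::
  "'v set \<Rightarrow> real \<Rightarrow> 'v protocol \<Rightarrow> 'v manet \<Rightarrow> nat \<Rightarrow> nat \<Rightarrow> bool" where
  "no_new_node_covered V r \<pi> M k \<beta> \<longleftrightarrow>
     (\<forall>T h. possible V r \<pi> M (T # h) \<and>
            card (covered V r M h) < k \<and> k \<le> card (covered V r M (T # h)) \<longrightarrow>
            card (covered V r M (T # h)) = k \<and>
            expected_newly_covered V r \<pi> M \<beta> (T # h) < 1)"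

end

theory Submission
  imports Defs
begin

text \<open>
  Let \<open>A\<close> be a set of \<open>k\<close> nodes containing the source, and \<open>b\<close> a node
  outside \<open>A\<close>. At slot boundaries \<open>A\<close> is a tiny cluster, with \<open>b\<close> on one
  side and all other nodes clustered on the opposite side, both at distance slightly less than \<open>r\<close>
  from \<open>A\<close>. A short excursion during a slot moves a node out of range and so breaks a link for that
  slot, at arbitrarily small speed. Until the first transmission \<open>A\<close> is an isolated clique, so the
  number of covered nodes jumps from \<open>1\<close> to \<open>k\<close>. During the next
  \<open>\<beta>\<close> slots only \<open>b\<close> is exposed, so at most one new node is covered, and it
  suffices that \<open>b\<close> stays uncovered with positive probability. Consider the play in which exactly
  the nodes of \<open>A\<close> that transmit with probability \<open>1\<close> transmit; it has positive
  probability. As \<open>\<beta> < k\<close>, some \<open>p\<close> in \<open>A\<close> is never the only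
  transmitter in it. Keep \<open>p\<close> linked to \<open>b\<close>, and link all of \<open>A\<close> to
  \<open>b\<close> exactly in the slots in which \<open>p\<close> is certain to transmit. After these
  \<open>\<beta>\<close> slots all links between \<open>A\<close> and the other nodes are up.
\<close>

section \<open>Expectations and distances in the plane\<close>

lemma mem_set_Pi_pmf_bernoulli:
  assumes "finite V"
  shows "f \<in> set_pmf (Pi_pmf V False (\<lambda>v. bernoulli_pmf (q v))) \<longleftrightarrow>
    (\<forall>v. if v \<in> V then f v \<in> set_pmf (bernoulli_pmf (q v)) else \<not> f v)"
  using assms by (auto simp: set_Pi_pmf PiE_dflt_def)

text \<open>\<open>f\<close> is dominated by the indicator of the complement of \<open>x\<close>,
  whose expectation \<open>1 - pmf p x\<close> is below 1 because \<open>x\<close> has positive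
  mass.\<close>

lemma expectation_lt_1:
  fixes f :: "'a \<Rightarrow> real"
  assumes x: "x \<in> set_pmf p" "f x = 0"
    and f: "\<And>y. y \<in> set_pmf p \<Longrightarrow> 0 \<le> f y \<and> f y \<le> 1"
  shows "measure_pmf.expectation p f < 1"
proof -
  have "measure_pmf.expectation p f \<le> measure_pmf.expectation p (indicator (- {x}))"
    using x(2) f
    by (intro integral_mono_AE measure_pmf.integrable_const_bound[where B = 1])
      (auto simp: AE_measure_pmf_iff indicator_def)
  also have "\<dots> = 1 - pmf p x"
    using measure_pmf.prob_compl[of "{x}" p] by (simp add: measure_pmf_single Compl_eq_Diff_UNIV)
  also have "\<dots> < 1"
    using x(1) by (simp add: pmf_positive)
  finally show ?thesis .
qed

lemma dist_vector_2_le: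
  "dist (vector [x, y] :: real^2) (vector [x', y']) \<le> \<bar>x - x'\<bar> + \<bar>y - y'\<bar>"
  using norm_le_l1_cart[of "(vector [x, y] :: real^2) - vector [x', y']"]
  by (simp add: dist_norm sum_2)

lemma abs_diff_le_dist_vector_2:
  "\<bar>x - x'\<bar> \<le> dist (vector [x, y] :: real^2) (vector [x', y'])"
  using component_le_norm_cart[of "(vector [x, y] :: real^2) - vector [x', y']" 1]
  by (simp add: dist_norm)

subsection \<open>Executions\<close>

text \<open>The recursion of \<open>exec\<close> peels off the earliest slot. Peeling off the latest
  one instead matches histories, which grow at the head.\<close>

lemma set_pmf_exec_Suc:
  "set_pmf (exec V r \<pi> M (Suc j) h) =
     {T # g | T g. g \<in> set_pmf (exec V r \<pi> M j h) \<and> T \<in> set_pmf (transmitters V r \<pi> M g)}"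
proof (induction j arbitrary: h)
  case 0
  show ?case by auto
next
  case (Suc j)
  have "set_pmf (exec V r \<pi> M (Suc (Suc j)) h) =
      (\<Union>S\<in>set_pmf (transmitters V r \<pi> M h). set_pmf (exec V r \<pi> M (Suc j) (S # h)))"
    by (subst exec.simps(2)) simp
  also have "\<dots> = {T # g | T g.
      g \<in> (\<Union>S\<in>set_pmf (transmitters V r \<pi> M h). set_pmf (exec V r \<pi> M j (S # h))) \<and>
      T \<in> set_pmf (transmitters V r \<pi> M g)}"
    unfolding Suc.IH by blast
  also have "(\<Union>S\<in>set_pmf (transmitters V r \<pi> M h). set_pmf (exec V r \<pi> M j (S # h))) =
      set_pmf (exec V r \<pi> M (Suc j) h)"
    by simp
  finally show ?case .
qed

declare exec.simps(2) [simp del]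

lemma exec_append:
  "h' \<in> set_pmf (exec V r \<pi> M j h) \<Longrightarrow> \<exists>xs. h' = xs @ h \<and> length xs = j"
proof (induction j arbitrary: h')
  case (Suc j)
  then obtain T g where "h' = T # g" "g \<in> set_pmf (exec V r \<pi> M j h)"
    by (auto simp: set_pmf_exec_Suc)
  with Suc.IH[of g] show ?case
    by (metis append_Cons length_Cons)
qed simp

lemma possible_Nil [simp]: "possible V r \<pi> M []"
  by (simp add: possible_def)

lemma possible_Cons:
  "possible V r \<pi> M (T # h) \<longleftrightarrow>
     possible V r \<pi> M h \<and> T \<in> set_pmf (transmitters V r \<pi> M h)"
  by (auto simp: possible_def set_pmf_exec_Suc)

lemma possible_exec:
  "h' \<in> set_pmf (exec V r \<pi> M j h) \<Longrightarrow> possible V r \<pi> M h \<Longrightarrow> possible V r \<pi> M h'"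
  by (induction j arbitrary: h') (auto simp: set_pmf_exec_Suc possible_Cons)

lemma length_history_at [simp]: "length (history_at \<omega> t) = t - 1"
  by (simp add: history_at_def)

lemma history_at_append:
  assumes "1 \<le> t" "t \<le> i"
  shows "\<exists>xs. history_at \<omega> i = xs @ history_at \<omega> t \<and> length xs = i - t"
proof -
  have "[1..<i] = [1..<t] @ [t..<i]"
    using assms upt_add_eq_append[of 1 t "i - t"] by simp
  then show ?thesis
    by (simp add: history_at_def)
qed

lemma receivers_D:
  assumes "u \<in> receivers V r M h T"
  shows "u \<in> V" "\<exists>v\<in>T \<inter> V. neighbors r M h u v"
  using assms by (auto simp: receivers_def)

lemma neighbors_sym: "neighbors r M h u v \<Longrightarrow> neighbors r M h v u"
  by (auto simp: neighbors_def dist_commute)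

lemma transmitters_subset_informed:
  assumes "finite V" and T: "T \<in> set_pmf (transmitters V r \<pi> M h)"
  shows "T \<subseteq> V \<inter> informed V r M h"
proof -
  obtain f where f: "f \<in> set_pmf (Pi_pmf V False (\<lambda>v. bernoulli_pmf (transmit_prob V r \<pi> M h v)))"
    and T_eq: "T = {v \<in> V. f v}"
    using T by (auto simp: transmitters_def)
  have "v \<in> informed V r M h" if "v \<in> V" "f v" for v
  proof (rule ccontr)
    assume "v \<notin> informed V r M h"
    then have "transmit_prob V r \<pi> M h v = 0"
      by (simp add: transmit_prob_def)
    moreover have "True \<in> set_pmf (bernoulli_pmf (transmit_prob V r \<pi> M h v))"
      using f that mem_set_Pi_pmf_bernoulli[OF \<open>finite V\<close>] by (metis (full_types))
    ultimately show False
      by (simp add: set_pmf_iff)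
  qed
  then show ?thesis
    by (auto simp: T_eq)
qed

subsection \<open>The adversary\<close>

text \<open>The history up to and including the first slot with a transmission; empty before that.\<close>

fun onset :: "'v history \<Rightarrow> 'v history" where
  "onset [] = []"
| "onset (T # h) = (if onset h \<noteq> [] then onset h else if T = {} then [] else T # h)"

lemma onset_onset [simp]: "onset (onset h) = onset h"
  by (induction h) auto

lemma onset_append: "onset h \<noteq> [] \<Longrightarrow> onset (xs @ h) = onset h"
  by (induction xs) auto

lemma onset_suffix: "\<exists>xs. h = xs @ onset h"
  by (induction h) (auto intro: exI[of _ "_ # _"])

lemma length_onset: "length (onset h) \<le> length h"
  by (induction h) auto

text \<open>No network is mentioned, so the adversary's motion can be defined from it; it agrees
  with \<open>schedule\<close> when all nodes are always active.\<close>

definition local_schedule :: "'v history \<Rightarrow> 'v \<Rightarrow> action list" where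
  "local_schedule h v = rev (map (\<lambda>T. if v \<in> T then Transmit else Receive) h)"

definition certain :: "'v protocol \<Rightarrow> 'v set \<Rightarrow> 'v history \<Rightarrow> 'v set" where
  "certain \<pi> A h = {a \<in> A. \<pi> a (Suc (length h)) (local_schedule h a) = 1}"

text \<open>Depends only on \<open>\<pi>\<close>, \<open>A\<close> and \<open>h\<close>, so the
  adversary can compute it at the onset, before these slots are played.\<close>

fun certain_play :: "'v protocol \<Rightarrow> 'v set \<Rightarrow> 'v history \<Rightarrow> nat \<Rightarrow> 'v history" where
  "certain_play \<pi> A h 0 = h"
| "certain_play \<pi> A h (Suc j) = certain \<pi> A (certain_play \<pi> A h j) # certain_play \<pi> A h j"

lemma certain_play_append: "\<exists>xs. certain_play \<pi> A h j = xs @ h \<and> length xs = j"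
  by (induction j) (auto intro: exI[of _ "_ # _"])

text \<open>\<open>8 * \<eta>\<close> is the top speed of an excursion of depth
  \<open>4 * \<eta>\<close> made and undone within one slot. \<open>A \<noteq> {s}\<close> supplies
  an uncovered neighbor of the source before the first transmission.\<close>

locale adversary =
  fixes V A :: "'v set" and s b :: 'v and r \<eta> vmax :: real and y :: "'v \<Rightarrow> real"
    and \<pi> :: "'v protocol" and \<beta> :: nat
  assumes fin: "finite V" and la: "locally_adaptive V \<pi>"
    and A_sub: "A \<subseteq> V" and s_in: "s \<in> A" and A_ne: "A \<noteq> {s}" and b_in: "b \<in> V" and b_notin: "b \<notin> A"
    and eta_pos: "0 < \<eta>" and eta_r: "4 * \<eta> \<le> r" and eta_vmax: "8 * \<eta> \<le> vmax"
    and inj_y: "inj_on y V" and y_bound: "\<And>v. v \<in> V \<Longrightarrow> 0 \<le> y v \<and> y v \<le> \<eta>"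
begin

text \<open>The guard \<open>\<beta> < card A\<close> makes a witness exist for every
  \<open>\<beta>\<close>; connectivity has to hold for large \<open>\<beta>\<close> too.\<close>

definition contact :: "'v history \<Rightarrow> 'v" where
  "contact h = (SOME p. p \<in> A \<and> (\<beta> < card A \<longrightarrow> (\<forall>j<\<beta>. certain \<pi> A (certain_play \<pi> A h j) \<noteq> {p})))"

text \<open>Pigeonhole: in \<open>\<beta>\<close> slots at most \<open>\<beta>\<close> nodes are
  ever the sole certain transmitter, and \<open>A\<close> has more members.\<close>

lemma contact_props:
  "contact h \<in> A" "\<beta> < card A \<Longrightarrow> j < \<beta> \<Longrightarrow> certain \<pi> A (certain_play \<pi> A h j) \<noteq> {contact h}"
proof -
  let ?Q = "\<lambda>p. p \<in> A \<and> (\<beta> < card A \<longrightarrow> (\<forall>j<\<beta>. certain \<pi> A (certain_play \<pi> A h j) \<noteq> {p}))"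
  have "\<exists>p. ?Q p"
  proof (cases "\<beta> < card A")
    case True
    \<comment> \<open>Off singletons \<open>the_elem\<close> is an unspecified value; such values
      may enter \<open>?S\<close>, but its size stays at most \<open>\<beta>\<close>.\<close>
    let ?S = "(\<lambda>j. the_elem (certain \<pi> A (certain_play \<pi> A h j))) ` {..<\<beta>}"
    have "card ?S \<le> \<beta>"
      using card_image_le[of "{..<\<beta>}"] by fastforce
    then have "\<not> A \<subseteq> ?S"
      using True card_mono[of ?S A] by fastforce
    then obtain p where "p \<in> A" "p \<notin> ?S"
      by blast
    then show ?thesis
      by (metis image_eqI lessThan_iff the_elem_eq)
  qed (use s_in in auto)
  then have "?Q (contact h)"
    unfolding contact_def by (rule someI_ex)
  then show "contact h \<in> A" "\<beta> < card A \<Longrightarrow> j < \<beta> \<Longrightarrow> certain \<pi> A (certain_play \<pi> A h j) \<noteq> {contact h}"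
    by blast+
qed

definition silent :: "'v history \<Rightarrow> bool" where
  "silent h \<longleftrightarrow> onset h = []"

definition attack :: "'v history \<Rightarrow> bool" where
  "attack h \<longleftrightarrow> onset h \<noteq> [] \<and> length h < length (onset h) + \<beta>"

text \<open>As \<open>onset h\<close> is frozen from the first transmission on, the link between its
  contact and \<open>b\<close> persists from then on.\<close>

definition linked :: "'v history \<Rightarrow> 'v \<Rightarrow> bool" where
  "linked h a \<longleftrightarrow> \<not> silent h \<and>
     (attack h \<longrightarrow> a = contact (onset h) \<or> contact (onset h) \<in> certain \<pi> A h)"

text \<open>
  The first coordinate of a node is \<open>rest\<close> at slot boundaries and \<open>rest - excursion\<close> in the middle of
  a slot; its second coordinate \<open>y\<close> never changes and keeps the nodes apart.
\<close>

definition rest :: "'v \<Rightarrow> real" where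
  "rest v = (if v \<in> A then 0 else if v = b then r - \<eta> else - (r - \<eta>))"

text \<open>Depth \<open>2 * \<eta>\<close> takes a node of \<open>A\<close> to distance at least
  \<open>r + \<eta>\<close> from \<open>b\<close>. Depth \<open>4 * \<eta>\<close> keeps the
  remaining nodes out of range even of nodes of \<open>A\<close> that move \<open>2 * \<eta>\<close>
  towards them.\<close>

definition excursion :: "'v history \<Rightarrow> 'v \<Rightarrow> real" where
  "excursion h v =
     (if v \<in> A then if linked h v then 0 else 2 * \<eta>
      else if v \<noteq> b \<and> (silent h \<or> attack h) then 4 * \<eta> else 0)"

definition pos :: "'v history \<Rightarrow> 'v \<Rightarrow> real \<Rightarrow> real" where
  "pos h v z = rest v - excursion h v * (1 - \<bar>2 * z - 1\<bar>)"

definition M :: "'v manet" where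
  "M = \<lparr>source = s, start = 1, motion = (\<lambda>h v z. vector [pos h v z, y v]), active = (\<lambda>_. V)\<rparr>"

lemma M_sel [simp]: "source M = s" "start M = 1" "active M h = V"
  "motion M h v z = vector [pos h v z, y v]"
  by (simp_all add: M_def)

lemma pos_0 [simp]: "pos h v 0 = rest v" and pos_1 [simp]: "pos h v 1 = rest v"
  and pos_half: "pos h v (1 / 2) = rest v - excursion h v"
  by (simp_all add: pos_def)

section \<open>Links in each phase\<close>

text \<open>The second coordinates use up at most \<open>\<eta>\<close> of the range in the taxicab
  bound on the distance.\<close>

lemma neighborsI:
  assumes "u \<in> V" "v \<in> V" "u \<noteq> v"
    and "\<And>z. z \<in> {0..1} \<Longrightarrow> \<bar>pos h u z - pos h v z\<bar> \<le> r - \<eta>"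
  shows "neighbors r M h u v"
  unfolding neighbors_def M_sel
proof (intro conjI ballI)
  fix z :: real assume "z \<in> {0..1}"
  then have "\<bar>pos h u z - pos h v z\<bar> \<le> r - \<eta>" by (rule assms(4))
  moreover have "\<bar>y u - y v\<bar> \<le> \<eta>"
    using y_bound[OF assms(1)] y_bound[OF assms(2)] by linarith
  ultimately show "dist (vector [pos h u z, y u] :: real^2) (vector [pos h v z, y v]) \<le> r"
    using dist_vector_2_le[of "pos h u z" "y u" "pos h v z" "y v"] by linarith
qed fact

text \<open>Taken in the middle of the slot, where excursions are deepest.\<close>

lemma neighborsD:
  assumes "neighbors r M h u v"
  shows "u \<noteq> v" "\<bar>(rest u - excursion h u) - (rest v - excursion h v)\<bar> \<le> r"
proof -
  have "dist (motion M h u (1/2)) (motion M h v (1/2)) \<le> r"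
    using assms by (auto simp: neighbors_def)
  then show "\<bar>(rest u - excursion h u) - (rest v - excursion h v)\<bar> \<le> r"
    using abs_diff_le_dist_vector_2[of "pos h u (1/2)" "pos h v (1/2)" "y u" "y v"]
    by (simp only: M_sel pos_half)
qed (use assms in \<open>auto simp: neighbors_def\<close>)

lemma neighbors_silent:
  assumes "silent h" "u \<in> A" "v \<in> A" "u \<noteq> v"
  shows "neighbors r M h u v"
  using assms A_sub eta_r eta_pos
  by (intro neighborsI) (auto simp: pos_def rest_def excursion_def linked_def)

lemma not_neighbors_silent:
  assumes "silent h" "u \<in> A" "neighbors r M h u v"
  shows "v \<in> A"
proof (rule ccontr)
  assume "v \<notin> A"
  then show False
    using neighborsD[OF assms(3)] assms(1,2) eta_pos b_notin
    by (auto simp: rest_def excursion_def linked_def split: if_splits)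
qed

lemma neighbors_linked:
  assumes "linked h a" "a \<in> A"
  shows "neighbors r M h a b"
  using assms A_sub b_in b_notin eta_pos eta_r
  by (intro neighborsI) (auto simp: pos_def rest_def excursion_def)

lemma linked_neighbors:
  assumes "a \<in> A" "neighbors r M h a b"
  shows "linked h a"
  using neighborsD[OF assms(2)] assms(1) eta_pos b_notin
  by (auto simp: rest_def excursion_def split: if_splits)

lemma not_neighbors_attack:
  assumes "attack h" "u \<in> A \<union> {b}" "neighbors r M h u v"
  shows "v \<in> A \<union> {b}"
proof (rule ccontr)
  assume "v \<notin> A \<union> {b}"
  then show False
    using neighborsD[OF assms(3)] assms(1,2) eta_pos eta_r b_notin
    by (auto simp: rest_def excursion_def split: if_splits)
qed

lemma neighbors_late:
  assumes "\<not> silent h" "\<not> attack h" "a \<in> A" "v \<in> V" "v \<notin> A"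
  shows "neighbors r M h a v"
  using assms A_sub eta_r eta_pos
  by (intro neighborsI) (auto simp: pos_def rest_def excursion_def linked_def)

section \<open>Evolution of the covered set\<close>

lemma schedule_eq: "v \<in> V \<Longrightarrow> schedule M h v = local_schedule h v"
  by (induction h) (auto simp: local_schedule_def)

text \<open>All nodes are always active, so none loses the information.\<close>

lemma informed_eq_covered: "informed V r M h = covered V r M h"
  and covered_subset: "covered V r M h \<subseteq> V"
proof -
  have "informed V r M h = covered V r M h \<and> covered V r M h \<subseteq> V"
    using s_in A_sub by (induction h) (auto simp: injected_def receivers_def)
  then show "informed V r M h = covered V r M h" "covered V r M h \<subseteq> V" by auto
qed

lemma covered_Nil [simp]: "covered V r M [] = {s}"
  by (simp add: injected_def slot_def)

lemma covered_Cons [simp]: "covered V r M (T # h) = covered V r M h \<union> receivers V r M h T"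
  by (simp add: injected_def slot_def)

declare covered.simps [simp del]

lemma possible_transmit:
  "possible V r \<pi> M (T # h) \<Longrightarrow> T \<subseteq> covered V r M h"
  using transmitters_subset_informed[OF fin, of T r \<pi> M h]
  by (auto simp: possible_Cons informed_eq_covered)

lemma receivers_empty [simp]: "receivers V r M h {} = {}"
  by (auto simp: receivers_def)

lemma receivers_source: "silent h \<Longrightarrow> receivers V r M h {s} = A - {s}"
proof (intro equalityI subsetI)
  fix u assume h: "silent h" and u: "u \<in> receivers V r M h {s}"
  then have "neighbors r M h u s"
    using receivers_D(2)[OF u] by blast
  then show "u \<in> A - {s}"
    using not_neighbors_silent[OF h s_in neighbors_sym] neighborsD(1) by blast
next
  fix u assume h: "silent h" and u: "u \<in> A - {s}"
  then have "neighbors r M h u s"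
    using neighbors_silent s_in by blast
  then show "u \<in> receivers V r M h {s}"
    using u A_sub s_in unfolding receivers_def by auto
qed

lemma covered_silent: "possible V r \<pi> M h \<Longrightarrow> silent h \<Longrightarrow> covered V r M h = {s}"
proof (induction h)
  case (Cons T h)
  then show ?case
    by (auto simp: silent_def possible_Cons split: if_splits)
qed simp

lemma covered_first:
  assumes "possible V r \<pi> M (T # h)" "silent h" "T \<noteq> {}"
  shows "covered V r M (T # h) = A"
proof -
  have "covered V r M h = {s}"
    using assms covered_silent possible_Cons by blast
  moreover from this have "T = {s}"
    using possible_transmit[OF assms(1)] assms(3) by auto
  ultimately show ?thesis
    using receivers_source[OF assms(2)] s_in by auto
qed

lemma A_subset_covered: "possible V r \<pi> M h \<Longrightarrow> \<not> silent h \<Longrightarrow> A \<subseteq> covered V r M h"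
proof (induction h)
  case (Cons T h)
  show ?case
  proof (cases "silent h")
    case True
    then have "T \<noteq> {}"
      using Cons.prems(2) by (auto simp: silent_def)
    then show ?thesis
      using covered_first Cons.prems(1) True by blast
  next
    case False
    then show ?thesis
      using Cons by (auto simp: possible_Cons)
  qed
qed (simp add: silent_def)

text \<open>Inductively all transmitters lie in \<open>A \<union> {b}\<close>, and no link leaves
  this set during the attack.\<close>

lemma covered_subset_attack:
  "possible V r \<pi> M h \<Longrightarrow> \<not> silent h \<Longrightarrow> length h \<le> length (onset h) + \<beta> \<Longrightarrow>
     covered V r M h \<subseteq> A \<union> {b}"
proof (induction h)
  case (Cons T h)
  show ?case
  proof (cases "silent h")
    case True
    then have "T \<noteq> {}"
      using Cons.prems(2) by (auto simp: silent_def)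
    then show ?thesis
      using covered_first Cons.prems(1) True by blast
  next
    case False
    \<comment> \<open>The weak length bound for \<open>T # h\<close> is the strict one for
      \<open>h\<close> that \<open>attack\<close> asks for.\<close>
    then have att: "attack h"
      using Cons.prems by (auto simp: silent_def attack_def)
    have IH: "covered V r M h \<subseteq> A \<union> {b}"
      using Cons False by (auto simp: possible_Cons silent_def)
    have "receivers V r M h T \<subseteq> A \<union> {b}"
    proof
      fix u assume "u \<in> receivers V r M h T"
      then obtain v where "v \<in> T" "neighbors r M h v u"
        using receivers_D(2) neighbors_sym by (metis IntE)
      moreover have "T \<subseteq> A \<union> {b}"
        using IH possible_transmit[OF Cons.prems(1)] by blast
      ultimately show "u \<in> A \<union> {b}"
        using not_neighbors_attack[OF att] by blast
    qed
    then show ?thesis using IH by simp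
  qed
qed (simp add: silent_def)

lemma covered_onset:
  assumes "possible V r \<pi> M h" "\<not> silent h"
  shows "covered V r M (onset h) = A"
  using assms
proof (induction h)
  case (Cons T h)
  show ?case
  proof (cases "silent h")
    case True
    then show ?thesis
      using covered_first[OF Cons.prems(1)] Cons.prems(2) by (auto simp: silent_def)
  next
    case False
    then show ?thesis
      using Cons by (auto simp: possible_Cons silent_def)
  qed
qed (simp add: silent_def)

section \<open>The play of the certain transmitters\<close>

text \<open>A node with probability below 1 can stay silent, and by independence all these outcomes
  can occur together.\<close>

lemma certain_in_transmitters:
  assumes "informed V r M h = A"
  shows "certain \<pi> A h \<in> set_pmf (transmitters V r \<pi> M h)"
proof -
  let ?q = "transmit_prob V r \<pi> M h"
  have q: "?q v = (if v \<in> A then \<pi> v (Suc (length h)) (local_schedule h v) else 0)" if "v \<in> V" for v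
    using that assms by (simp add: transmit_prob_def schedule_eq local_schedule_def)
  have bnd: "0 \<le> ?q v \<and> ?q v \<le> 1" if "v \<in> V" for v
  proof -
    have "length (local_schedule h v) = Suc (length h) - 1"
      by (simp add: local_schedule_def)
    then have "0 \<le> \<pi> v (Suc (length h)) (local_schedule h v) \<and>
        \<pi> v (Suc (length h)) (local_schedule h v) \<le> 1"
      using la that unfolding locally_adaptive_def by (metis le_add1 plus_1_eq_Suc)
    then show ?thesis
      using q[OF that] by auto
  qed
  have "(v \<in> certain \<pi> A h) \<in> set_pmf (bernoulli_pmf (?q v))" if v: "v \<in> V" for v
  proof (cases "v \<in> certain \<pi> A h")
    case True
    then have "?q v = 1" using q[OF v] by (auto simp: certain_def)
    then show ?thesis using True by (simp add: set_pmf_iff)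
  next
    case False
    then have "?q v \<noteq> 1" using q[OF v] by (auto simp: certain_def)
    then show ?thesis using False bnd[OF v] by (simp add: set_pmf_iff)
  qed
  moreover have "certain \<pi> A h \<subseteq> V"
    using A_sub by (auto simp: certain_def)
  ultimately have "(\<lambda>v. v \<in> certain \<pi> A h) \<in> set_pmf (Pi_pmf V False (\<lambda>v. bernoulli_pmf (?q v)))"
    by (auto simp: mem_set_Pi_pmf_bernoulli[OF fin])
  then have "{v \<in> V. v \<in> certain \<pi> A h} \<in> set_pmf (transmitters V r \<pi> M h)"
    unfolding transmitters_def set_map_pmf by (rule imageI)
  moreover have "{v \<in> V. v \<in> certain \<pi> A h} = certain \<pi> A h"
    using \<open>certain \<pi> A h \<subseteq> V\<close> by auto
  ultimately show ?thesis
    by simp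
qed

text \<open>
  When the set of certain transmitters contains the chosen neighbor of \<open>b\<close>, it has a further member,
  and the two collide at \<open>b\<close>; otherwise the only neighbor of \<open>b\<close> in \<open>A\<close> is silent.
\<close>

lemma receivers_certain:
  assumes att: "attack h" and ne: "certain \<pi> A h \<noteq> {contact (onset h)}"
  shows "receivers V r M h (certain \<pi> A h) \<subseteq> A"
proof
  let ?S = "certain \<pi> A h"
  fix u assume u: "u \<in> receivers V r M h ?S"
  have S: "?S \<subseteq> A" by (auto simp: certain_def)
  obtain v where "v \<in> ?S" "neighbors r M h v u"
    using receivers_D(2)[OF u] neighbors_sym by (metis IntE)
  then have "u \<in> A \<union> {b}"
    using S not_neighbors_attack[OF att] by blast
  moreover have "u \<noteq> b"
  proof
    assume "u = b"
    let ?N = "{w \<in> V. w \<in> ?S \<and> (w = b \<or> neighbors r M h b w)}"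
    obtain v where v: "?N = {v}"
      using u \<open>u = b\<close> by (auto simp: receivers_def)
    have "v \<in> ?N"
      unfolding v by simp
    then have v': "v \<in> ?S" "neighbors r M h v b"
      using b_notin S neighbors_sym[of r M h b v] by auto
    have "linked h v"
      using v' S linked_neighbors by blast
    then have "contact (onset h) \<in> ?S"
      using v' att by (auto simp: linked_def)
    then obtain q where q: "q \<in> ?S" "q \<noteq> v"
      using ne v'(1) by blast
    have "linked h q"
      using \<open>contact (onset h) \<in> ?S\<close> att by (auto simp: linked_def silent_def attack_def)
    then have "neighbors r M h b q"
      using q S neighbors_linked[of h q] neighbors_sym[of r M h q b] by blast
    then have "q \<in> ?N"
      using q(1) S A_sub by auto
    then show False
      unfolding v using q(2) by simp
  qed
  ultimately show "u \<in> A" by blast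
qed

text \<open>While exactly \<open>A\<close> is covered, the next slot of the play is possible, and by
  the choice of the contact it delivers nothing outside \<open>A\<close>.\<close>

lemma certain_play_covered:
  assumes h: "possible V r \<pi> M h" "onset h = h" "h \<noteq> []" and "\<beta> < card A" and "j \<le> \<beta>"
  shows "certain_play \<pi> A h j \<in> set_pmf (exec V r \<pi> M j h) \<and>
    covered V r M (certain_play \<pi> A h j) = A"
  using \<open>j \<le> \<beta>\<close>
proof (induction j)
  case 0
  then show ?case
    using covered_onset[OF h(1)] h by (simp add: silent_def)
next
  case (Suc j)
  let ?g = "certain_play \<pi> A h j"
  have IH: "?g \<in> set_pmf (exec V r \<pi> M j h)" "covered V r M ?g = A"
    using Suc by auto
  obtain xs where xs: "?g = xs @ h" "length xs = j"
    using certain_play_append by blast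
  have on: "onset ?g = h"
    using xs onset_append[of h xs] h by simp
  have "attack ?g"
    using on xs Suc.prems h by (auto simp: attack_def)
  moreover have "certain \<pi> A ?g \<noteq> {contact (onset ?g)}"
    using contact_props(2)[OF \<open>\<beta> < card A\<close>, of j h] Suc.prems on by simp
  ultimately have "receivers V r M ?g (certain \<pi> A ?g) \<subseteq> A"
    by (rule receivers_certain)
  moreover have "certain \<pi> A ?g \<in> set_pmf (transmitters V r \<pi> M ?g)"
    using IH by (intro certain_in_transmitters) (simp add: informed_eq_covered)
  ultimately show ?case
    using IH by (auto simp: set_pmf_exec_Suc)
qed

section \<open>Verification of the required properties\<close>

lemma is_manet: "is_manet V r vmax \<pi> M"
  unfolding is_manet_def
proof (intro conjI allI impI ballI)
  fix h v and x z :: real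
  have "0 \<le> excursion h v \<and> excursion h v \<le> 4 * \<eta>"
    using eta_pos by (auto simp: excursion_def)
  moreover have "\<bar>\<bar>2 * x - 1\<bar> - \<bar>2 * z - 1\<bar>\<bar> \<le> 2 * \<bar>x - z\<bar>"
    using abs_triangle_ineq3[of "2 * x - 1" "2 * z - 1"] by (simp add: abs_if split: if_splits)
  ultimately have "excursion h v * \<bar>\<bar>2 * x - 1\<bar> - \<bar>2 * z - 1\<bar>\<bar> \<le> (4 * \<eta>) * (2 * \<bar>x - z\<bar>)"
    by (intro mult_mono) auto
  also have "\<dots> \<le> vmax * \<bar>x - z\<bar>"
    using mult_right_mono[OF eta_vmax, of "\<bar>x - z\<bar>"] by simp
  finally have "excursion h v * \<bar>\<bar>2 * x - 1\<bar> - \<bar>2 * z - 1\<bar>\<bar> \<le> vmax * \<bar>x - z\<bar>" .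
  moreover have "\<bar>pos h v x - pos h v z\<bar> = excursion h v * \<bar>\<bar>2 * x - 1\<bar> - \<bar>2 * z - 1\<bar>\<bar>"
  proof -
    have "pos h v x - pos h v z = excursion h v * (\<bar>2 * z - 1\<bar> - \<bar>2 * x - 1\<bar>) * (-1)"
      by (simp add: pos_def algebra_simps)
    then show ?thesis
      using \<open>0 \<le> excursion h v \<and> _\<close> by (simp add: abs_mult abs_minus_commute)
  qed
  ultimately show "dist (motion M h v x) (motion M h v z) \<le> vmax * \<bar>x - z\<bar>"
    using dist_vector_2_le[of "pos h v x" "y v" "pos h v z" "y v"] by simp
next
  fix h u v and z :: real
  assume "u \<in> V" "v \<in> V" "u \<noteq> v"
  then have "y u \<noteq> y v"
    using inj_y by (auto dest: inj_onD)
  then show "motion M h u z \<noteq> motion M h v z"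
    by (metis M_sel(4) vector_2(2))
qed (use s_in A_sub in auto)

lemma all_targets: "r \<le> d \<Longrightarrow> all_targets V r d \<pi> M"
  unfolding all_targets_def targets_def
proof (intro allI impI)
  fix h :: "'v history"
  assume d: "r \<le> d"
  have "dist (motion M h v 0) (motion M h (source M) 0) \<le> d" if "v \<in> V" for v
  proof -
    have "\<bar>rest v - rest s\<bar> \<le> r - \<eta>"
      using s_in eta_pos eta_r by (auto simp: rest_def)
    moreover have "\<bar>y v - y s\<bar> \<le> \<eta>"
      using y_bound[OF that] y_bound[OF subsetD[OF A_sub s_in]] by linarith
    ultimately show ?thesis
      using dist_vector_2_le[of "rest v" "y v" "rest s" "y s"] d by simp
  qed
  then show "{v \<in> V \<inter> active M h. dist (motion M h v 0) (motion M h (source M) 0) \<le> d} = V"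
    by auto
qed

lemma simultaneous: "simultaneous_without_failures V r \<pi> M"
  unfolding simultaneous_without_failures_def by (rule exI[of _ 0]) auto

text \<open>The count can reach \<open>k\<close> only in the slot of the first transmission.
  Afterwards the number of new nodes is 0 or 1, and it is 0 on \<open>certain_play\<close>.\<close>

lemma no_new_node:
  assumes k: "card A = k" "\<beta> < k"
  shows "no_new_node_covered V r \<pi> M k \<beta>"
  unfolding no_new_node_covered_def
proof (intro allI impI, elim conjE)
  fix T h assume po: "possible V r \<pi> M (T # h)"
    and lt: "card (covered V r M h) < k" and le: "k \<le> card (covered V r M (T # h))"
  have fin_cov: "finite (covered V r M g)" for g
    using covered_subset fin by (rule finite_subset)
  have "silent h"
  proof (rule ccontr)
    assume "\<not> silent h"
    then have "A \<subseteq> covered V r M h"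
      using A_subset_covered[of h] po by (simp add: possible_Cons)
    then have "card A \<le> card (covered V r M h)"
      by (intro card_mono fin_cov)
    then show False
      using lt k by linarith
  qed
  moreover have "T \<noteq> {}"
    using lt le by auto
  ultimately have cov: "covered V r M (T # h) = A" and on: "onset (T # h) = T # h"
    using covered_first[OF po] by (auto simp: silent_def)
  have "expected_newly_covered V r \<pi> M \<beta> (T # h) < 1"
    unfolding expected_newly_covered_def
  proof (rule expectation_lt_1)
    let ?g = "certain_play \<pi> A (T # h) \<beta>"
    have *: "?g \<in> set_pmf (exec V r \<pi> M \<beta> (T # h)) \<and> covered V r M ?g = A"
      using certain_play_covered[OF po on] k by simp
    then show "?g \<in> set_pmf (exec V r \<pi> M \<beta> (T # h))" ..
    show "real (card (covered V r M ?g - covered V r M (T # h))) = 0"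
      using * cov by simp
  next
    fix g assume g: "g \<in> set_pmf (exec V r \<pi> M \<beta> (T # h))"
    then obtain xs where xs: "g = xs @ T # h" "length xs = \<beta>"
      using exec_append by blast
    have "onset g = T # h"
      using xs onset_append[of "T # h" xs] on by simp
    then have "covered V r M g \<subseteq> A \<union> {b}"
      using xs possible_exec[OF g po] by (intro covered_subset_attack) (auto simp: silent_def)
    then have "covered V r M g - covered V r M (T # h) \<subseteq> {b}"
      using cov by blast
    then have "card (covered V r M g - covered V r M (T # h)) \<le> card {b}"
      by (intro card_mono) simp
    then show "0 \<le> real (card (covered V r M g - covered V r M (T # h))) \<and>
        real (card (covered V r M g - covered V r M (T # h))) \<le> 1"
      by simp
  qed
  then show "card (covered V r M (T # h)) = k \<and>
      expected_newly_covered V r \<pi> M \<beta> (T # h) < 1"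
    using cov k by simp
qed

lemma neighbors_contact:
  assumes "\<not> silent h"
  shows "neighbors r M h (contact (onset h)) b"
  using assms contact_props(1) by (intro neighbors_linked) (auto simp: linked_def)

lemma ab_connected:
  assumes beta: "0 < \<beta>" and d: "r \<le> d"
  shows "ab_connected \<alpha> \<beta> V r d \<pi> M"
  unfolding ab_connected_def M_sel
proof (intro allI impI)
  fix \<omega> :: "nat \<Rightarrow> 'v set" and t :: nat
  assume run: "run V r \<pi> M \<omega>" and t: "1 \<le> t" and uns: "\<not> solved V r d M \<omega> t"
  let ?H = "history_at \<omega>"
  have po: "possible V r \<pi> M (?H i)" if "1 \<le> i" for i
    using run that by (simp add: run_def)
  have meet: "{t..t + \<alpha>} \<inter> {t'..<t' + \<beta>} \<noteq> {}" if "t' \<le> t" "t < t' + \<beta>" for t'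
  proof -
    have "t \<in> {t..t + \<alpha>} \<inter> {t'..<t' + \<beta>}"
      using that by simp
    then show ?thesis by blast
  qed
  let ?goal = "\<lambda>t' p p'. 1 \<le> t' \<and> {t..t + \<alpha>} \<inter> {t'..<t' + \<beta>} \<noteq> {} \<and> p \<in> V \<and> p' \<in> V \<and>
      p \<in> covered V r M (?H t') \<and> p' \<notin> covered V r M (?H t') \<and>
      (\<forall>i\<in>{t'..<t' + \<beta>}. p' \<notin> covered V r M (?H i) \<longrightarrow> neighbors r M (?H i) p p')"
  have "\<exists>t' p p'. ?goal t' p p'"
  proof (cases "silent (?H t)")
    case True
    obtain a where a: "a \<in> A" "a \<noteq> s"
      using s_in A_ne by blast
    have cov: "covered V r M (?H t) = {s}"
      using covered_silent[OF po[OF t] True] .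
    \<comment> \<open>The link is needed only while \<open>a\<close> is uncovered, and that means
      that no transmission has happened yet.\<close>
    have "neighbors r M (?H i) s a"
      if "i \<in> {t..<t + \<beta>}" "a \<notin> covered V r M (?H i)" for i
    proof -
      have "silent (?H i)"
        using that t a A_subset_covered[OF po[of i]] by auto
      then show ?thesis
        using neighbors_silent s_in a by blast
    qed
    then have "?goal t s a"
      using t a cov s_in A_sub meet[of t] beta by (intro conjI) auto
    then show ?thesis by blast
  next
    case False
    note ns = this
    show ?thesis
    proof (cases "attack (?H t)")
      case True
      let ?o = "onset (?H t)"
      \<comment> \<open>At slot \<open>t\<close> the node \<open>b\<close> may already be covered,
        so the window starts with the attack, when exactly \<open>A\<close> is covered; its
        \<open>\<beta>\<close> slots include \<open>t\<close>.\<close>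
      let ?t = "Suc (length ?o)"
      have len: "?t \<le> t"
        using length_onset[of "?H t"] t by simp
      obtain xs where "?H t = xs @ ?H ?t" "length xs = t - ?t"
        using history_at_append[of ?t t \<omega>] len by auto
      moreover obtain ys where "?H t = ys @ ?o"
        using onset_suffix by blast
      ultimately have Ht: "?H ?t = ?o"
        by (metis append_eq_append_conv diff_Suc_1 length_history_at)
      have on: "onset (?H i) = ?o" if "?t \<le> i" for i
        using history_at_append[of ?t i \<omega>] that onset_append[of ?o] ns Ht
        by (auto simp: silent_def)
      have "neighbors r M (?H i) (contact ?o) b" if "?t \<le> i" for i
        using neighbors_contact[of "?H i"] on[OF that] ns by (auto simp: silent_def)
      moreover have "covered V r M (?H ?t) = A"
        using covered_onset[OF po[OF t] ns] Ht by simp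
      moreover have "t < ?t + \<beta>"
        using True t by (auto simp: attack_def)
      ultimately have "?goal ?t (contact ?o) b"
        using contact_props(1)[of ?o] A_sub b_in b_notin meet[OF len] by (intro conjI) auto
      then show ?thesis by blast
    next
      case False
      have "targets V d M (?H 1) = V"
        using all_targets[OF d] by (simp add: all_targets_def slot_def history_at_def)
      then obtain u where u: "u \<in> V" "u \<notin> covered V r M (?H t)"
        using uns by (auto simp: solved_def)
      have cov: "A \<subseteq> covered V r M (?H t)"
        using A_subset_covered[OF po[OF t] ns] .
      \<comment> \<open>The phase after the attack never ends, so this link persists.\<close>
      have "neighbors r M (?H i) s u" if ti: "t \<le> i" for i
      proof -
        obtain xs where xs: "?H i = xs @ ?H t"
          using history_at_append[OF t ti] by blast
        have "onset (?H i) = onset (?H t)"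
          using xs onset_append ns by (auto simp: silent_def)
        then have "\<not> silent (?H i)" "\<not> attack (?H i)"
          using ns False xs by (auto simp: silent_def attack_def)
        then show ?thesis
          using neighbors_late s_in u cov by blast
      qed
      then have "?goal t s u"
        using t u cov s_in A_sub meet[of t] beta by (intro conjI) auto
      then show ?thesis by blast
    qed
  qed
  then show "\<exists>t'\<ge>1. {t..t + \<alpha>} \<inter> {t'..<t' + \<beta>} \<noteq> {} \<and>
     (\<exists>p\<in>V. \<exists>p'\<in>V. p \<in> informed V r M (?H t') \<and> p' \<notin> covered V r M (?H t') \<and>
        (\<forall>i\<in>{t'..<t' + \<beta>}. p' \<notin> covered V r M (?H i) \<longrightarrow>
           p \<in> V \<and> p' \<in> V \<and> neighbors r M (?H i) p p'))"
    unfolding informed_eq_covered by blast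
qed

end

section \<open>Numerical bounds and choice of the parameters\<close>

theorem theorem8:
  fixes V :: "'v set" and \<pi> :: "'v protocol"
    and n k \<alpha> \<beta> :: nat and r d vmax \<xi> \<delta> \<Gamma> :: real
  assumes "finite V" and "card V = n"
    and "locally_adaptive V \<pi>"
    and "0 < r" and "r < d" and "0 < vmax" and "0 < \<beta>" and "0 < k"
    and xi: "\<xi> = 2 / (1 - 1 / exp 1)\<^sup>2"
    and delta: "\<delta> = (real \<beta>)\<^sup>2 * real k powr (exp 1 / \<xi>)"
    and Gamma: "\<Gamma> = \<xi> * ln \<delta>"
    and "(2 / (1 - 1 / exp 1)) powr (\<xi> / exp 1) < real k" and "k < n"
  shows "\<exists>M. is_manet V r vmax \<pi> M \<and> ab_connected \<alpha> \<beta> V r d \<pi> M \<and>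
           all_targets V r d \<pi> M \<and> simultaneous_without_failures V r \<pi> M \<and>
           (real \<beta> < real k / (2 * exp 1 * \<Gamma>) \<longrightarrow> no_new_node_covered V r \<pi> M k \<beta>)"
proof -
  define c :: real where "c = 1 - 1 / exp 1"
  have c: "0 < c" "c < 1"
    by (auto simp: c_def)
  have c2: "2 < 2 / c"
    using c by (simp add: field_simps)
  have xi2: "2 \<le> \<xi>"
    using c by (simp add: xi c_def[symmetric] field_simps power_le_one)
  have kc: "(2 / c) powr (\<xi> / exp 1) < real k"
    using assms(12) by (simp add: c_def)
  moreover have "1 \<le> (2 / c) powr (\<xi> / exp 1)"
    using c2 xi2 by (intro ge_one_powr_ge_zero) auto
  ultimately have k1: "1 < k"
    by linarith
  \<comment> \<open>The lower bound on \<open>k\<close> yields \<open>\<delta> > 2\<close>. With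
    \<open>\<xi> \<ge> 2\<close> this gives \<open>\<Gamma> \<ge> 1\<close>, so the bound on
    \<open>\<beta>\<close> implies \<open>\<beta> < k\<close>.\<close>
  have "2 < 2 / c" by (rule c2)
  also have "2 / c = ((2 / c) powr (\<xi> / exp 1)) powr (exp 1 / \<xi>)"
    using c xi2 by (simp add: powr_powr)
  also have "\<dots> < real k powr (exp 1 / \<xi>)"
    using kc xi2 by (intro powr_less_mono2) auto
  also have "\<dots> \<le> \<delta>"
    using \<open>0 < \<beta>\<close> mult_right_mono[of 1 "(real \<beta>)\<^sup>2" "real k powr (exp 1 / \<xi>)"]
    by (simp add: delta)
  finally have "ln 2 < ln \<delta>"
    by simp
  then have "2 * (1 / 2) \<le> \<Gamma>"
    unfolding Gamma using xi2 ln2_ge_two_thirds by (intro mult_mono) auto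
  then have "2 * 1 * 1 \<le> 2 * exp 1 * \<Gamma>"
    by (intro mult_mono) auto
  then have "real k / (2 * exp 1 * \<Gamma>) \<le> real k / 1"
    by (intro frac_le) linarith+
  then have beta_lt: "\<beta> < k" if "real \<beta> < real k / (2 * exp 1 * \<Gamma>)"
    using that by linarith

  obtain A where A: "A \<subseteq> V" "card A = k"
    using \<open>k < n\<close> assms(2) by (metis less_imp_le obtain_subset_with_card_n)
  then obtain s where s: "s \<in> A"
    using k1 by fastforce
  obtain b where b: "b \<in> V" "b \<notin> A"
    using A \<open>k < n\<close> assms(2) by (metis less_irrefl subsetI subset_antisym)
  define \<eta> where "\<eta> = min (r / 4) (vmax / 8)"
  obtain f :: "'v \<Rightarrow> nat" where f: "inj_on f V"
    using finite_imp_inj_to_nat_seg \<open>finite V\<close> by metis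
  have eta: "0 < \<eta>" "4 * \<eta> \<le> r" "8 * \<eta> \<le> vmax"
    using assms(4,6) by (auto simp: \<eta>_def)
  \<comment> \<open>Injectivity of \<open>f\<close> makes the offsets
    \<open>\<eta> / Suc (f v)\<close> distinct values in the interval from 0 to
    \<open>\<eta>\<close>.\<close>
  interpret adversary V A s b r \<eta> vmax "\<lambda>v. \<eta> / Suc (f v)" \<pi> \<beta>
  proof
    show "inj_on (\<lambda>v. \<eta> / real (Suc (f v))) V"
      using f eta by (auto simp: inj_on_def)
    show "A \<noteq> {s}"
      using A k1 by auto
    show "0 \<le> \<eta> / real (Suc (f v)) \<and> \<eta> / real (Suc (f v)) \<le> \<eta>" for v
      using eta by (simp add: field_simps)
  qed (use assms A s b eta in simp_all)
  show ?thesis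
    using is_manet ab_connected all_targets simultaneous no_new_node A beta_lt assms(5,7)
    by (intro exI[of _ M]) auto
qed

end
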